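(* If $g\in\mathbb C[t]$ is a nonconstant even polynomial (i.e. only even powers of $t$ occur in $g$), then the $\mathfrak{sl}(2)$-modules $T_3(g)^{\mathrm{ev}}$ and $T_3(g)^{\mathrm{odd}}$ are simple.
   Context: The Lie algebra $\mathfrak{sl}(2)$ over $\mathbb C$ has basis $e,f,h$ with $[h,e]=e$, $[h,f]=-f$, $[e,f]=2h$. $T_3(g)$ denotes the space $\mathbb C[t]e^g$ (with $\partial=d/dt$ acting by $\partial(pe^g)=(p'+pg')e^g$) regarded as an $\mathfrak{sl}(2)$-module via $e\mapsto\tfrac12t^2$, $f\mapsto-\tfrac12\partial^2$, $h\mapsto\tfrac12t\partial+\tfrac14$. For $g$ even, $T_3(g)^{\mathrm{ev}}:=\mathbb C[t]_{\mathrm{ev}}e^g$ and $T_3(g)^{\mathrm{odd}}:=\mathbb C[t]_{\mathrm{odd}}e^g$ are submodules of $T_3(g)$, where $\mathbb C[t]_{\mathrm{ev}}=\mathrm{Span}\{t^{2k}:k\geq0\}$ and $\mathbb C[t]_{\mathrm{odd}}=\mathrm{Span}\{t^{2k+1}:k\geq0\}$. *)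

theory Defs
  imports
    "HOL-Complex_Analysis.Complex_Analysis"
    "HOL-Library.Function_Algebras"
    "HOL-Computational_Algebra.Polynomial"
begin

unbundle no fps_syntax

section \<open>Lie algebras and their modules\<close>

text \<open>Lie algebras and modules are given by carriers, which are subspaces of ambient vector
  spaces; bracket and action are only constrained on the carriers.\<close>

locale lie_algebra = vector_space scaleL
  for scaleL :: "'k::field \<Rightarrow> 'l::ab_group_add \<Rightarrow> 'l" +
  fixes L :: "'l set"
    and bracket :: "'l \<Rightarrow> 'l \<Rightarrow> 'l"
  assumes subspace_L: "subspace L"
    and bracket_closed: "\<lbrakk>x \<in> L; y \<in> L\<rbrakk> \<Longrightarrow> bracket x y \<in> L"
    and bracket_add_left:
      "\<lbrakk>x \<in> L; y \<in> L; z \<in> L\<rbrakk> \<Longrightarrow> bracket (x + y) z = bracket x z + bracket y z"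
    and bracket_add_right:
      "\<lbrakk>x \<in> L; y \<in> L; z \<in> L\<rbrakk> \<Longrightarrow> bracket x (y + z) = bracket x y + bracket x z"
    and bracket_scale_left:
      "\<lbrakk>x \<in> L; y \<in> L\<rbrakk> \<Longrightarrow> bracket (scaleL c x) y = scaleL c (bracket x y)"
    and bracket_scale_right:
      "\<lbrakk>x \<in> L; y \<in> L\<rbrakk> \<Longrightarrow> bracket x (scaleL c y) = scaleL c (bracket x y)"
    and bracket_self: "x \<in> L \<Longrightarrow> bracket x x = 0"
    and jacobi:
      "\<lbrakk>x \<in> L; y \<in> L; z \<in> L\<rbrakk> \<Longrightarrow>
        bracket x (bracket y z) + bracket y (bracket z x) + bracket z (bracket x y) = 0"

locale lie_module =
  lie_algebra scaleL L bracket + V: vector_space scaleV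
  for scaleL :: "'k::field \<Rightarrow> 'l::ab_group_add \<Rightarrow> 'l"
    and L :: "'l set"
    and bracket :: "'l \<Rightarrow> 'l \<Rightarrow> 'l"
    and scaleV :: "'k \<Rightarrow> 'v::ab_group_add \<Rightarrow> 'v" +
  fixes V :: "'v set"
    and act :: "'l \<Rightarrow> 'v \<Rightarrow> 'v"
  assumes subspace_V: "V.subspace V"
    and act_closed: "\<lbrakk>x \<in> L; v \<in> V\<rbrakk> \<Longrightarrow> act x v \<in> V"
    and act_add_left:
      "\<lbrakk>x \<in> L; y \<in> L; v \<in> V\<rbrakk> \<Longrightarrow> act (x + y) v = act x v + act y v"
    and act_add_right:
      "\<lbrakk>x \<in> L; v \<in> V; w \<in> V\<rbrakk> \<Longrightarrow> act x (v + w) = act x v + act x w"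
    and act_scale_left:
      "\<lbrakk>x \<in> L; v \<in> V\<rbrakk> \<Longrightarrow> act (scaleL c x) v = scaleV c (act x v)"
    and act_scale_right:
      "\<lbrakk>x \<in> L; v \<in> V\<rbrakk> \<Longrightarrow> act x (scaleV c v) = scaleV c (act x v)"
    and act_bracket:
      "\<lbrakk>x \<in> L; y \<in> L; v \<in> V\<rbrakk> \<Longrightarrow> act (bracket x y) v = act x (act y v) - act y (act x v)"
begin

definition submodule :: "'v set \<Rightarrow> bool" where
  "submodule W \<longleftrightarrow> W \<subseteq> V \<and> V.subspace W \<and> (\<forall>x\<in>L. \<forall>w\<in>W. act x w \<in> W)"

end

locale simple_lie_module = lie_module +
  assumes nonzero: "V \<noteq> {0}"
    and simple: "submodule W \<Longrightarrow> W = {0} \<or> W = V"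


section \<open>The Lie algebra sl(2) over the complex numbers\<close>

definition sl2 :: "(complex^2^2) set" where
  "sl2 = {A. trace A = 0}"

definition sl2_scale :: "complex \<Rightarrow> complex^2^2 \<Rightarrow> complex^2^2" where
  "sl2_scale c A = (\<chi> i j. c * A $ i $ j)"

definition sl2_bracket :: "complex^2^2 \<Rightarrow> complex^2^2 \<Rightarrow> complex^2^2" where
  "sl2_bracket A B = A ** B - B ** A"

definition sl2_e :: "complex^2^2" where
  "sl2_e = vector [vector [0, 1], vector [0, 0]]"

definition sl2_f :: "complex^2^2" where
  "sl2_f = vector [vector [0, 0], vector [1, 0]]"

text \<open>Half of the usual Cartan element, so that $[h,e]=e$, $[h,f]=-f$ and $[e,f]=2h$.\<close>

definition sl2_h :: "complex^2^2" where
  "sl2_h = vector [vector [1/2, 0], vector [0, -1/2]]"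

lemmas sl2_basis_defs = sl2_e_def sl2_f_def sl2_h_def

lemma sl2_basis_mem: "sl2_e \<in> sl2" "sl2_f \<in> sl2" "sl2_h \<in> sl2"
  by (simp_all add: sl2_def sl2_basis_defs trace_def sum_2)

lemma sl2_relations:
  "sl2_bracket sl2_h sl2_e = sl2_e"
  "sl2_bracket sl2_h sl2_f = - sl2_f"
  "sl2_bracket sl2_e sl2_f = sl2_scale 2 sl2_h"
  by (simp_all add: sl2_bracket_def sl2_scale_def sl2_basis_defs vec_eq_iff forall_2
      matrix_matrix_mult_def sum_2)

lemma sl2_coordinates:
  assumes "A \<in> sl2"
  shows "A = sl2_scale x sl2_e + sl2_scale y sl2_f + sl2_scale z sl2_h \<longleftrightarrow>
    x = A $ 1 $ 2 \<and> y = A $ 2 $ 1 \<and> z = 2 * A $ 1 $ 1"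
proof -
  have "A $ 2 $ 2 = - A $ 1 $ 1"
    using assms by (simp add: sl2_def trace_def sum_2 add_eq_0_iff)
  then show ?thesis
    by (auto simp: sl2_scale_def sl2_basis_defs vec_eq_iff forall_2)
qed

lemma lie_algebra_sl2: "lie_algebra sl2_scale sl2 sl2_bracket"
proof -
  interpret vector_space sl2_scale
    by unfold_locales (simp_all add: sl2_scale_def vec_eq_iff algebra_simps)
  show ?thesis
  proof unfold_locales
    show "subspace sl2"
      by (simp add: subspace_def sl2_def sl2_scale_def trace_def sum_distrib_left[symmetric]
          sum.distrib)
  qed (simp_all add: sl2_def sl2_scale_def sl2_bracket_def trace_def sum_2 vec_eq_iff forall_2
      matrix_matrix_mult_def algebra_simps)
qed


section \<open>The modules\<close>

text \<open>Elements $p e^g$ of $\mathbb{C}[t]e^g$ are realised as entire functions of $t$, and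
  $\partial$ is the complex derivative; it satisfies $\partial(pe^g)=(p'+pg')e^g$, and
  $p\mapsto pe^g$ is injective, by the two lemmas below.\<close>

definition poly_exp :: "complex poly \<Rightarrow> complex poly \<Rightarrow> complex \<Rightarrow> complex" where
  "poly_exp g p = (\<lambda>t. poly p t * exp (poly g t))"

lemma deriv_poly_exp: "deriv (poly_exp g p) = poly_exp g (pderiv p + p * pderiv g)"
  by (rule ext, rule DERIV_imp_deriv)
    (auto simp: poly_exp_def algebra_simps intro!: derivative_eq_intros)

lemma inj_poly_exp: "inj (poly_exp g)"
  by (rule injI) (simp add: poly_exp_def fun_eq_iff flip: poly_eq_poly_eq_iff)

definition fun_scale :: "complex \<Rightarrow> (complex \<Rightarrow> complex) \<Rightarrow> complex \<Rightarrow> complex" where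
  "fun_scale c F = (\<lambda>t. c * F t)"

definition T3_e :: "(complex \<Rightarrow> complex) \<Rightarrow> complex \<Rightarrow> complex" where
  "T3_e F = (\<lambda>t. 1/2 * t^2 * F t)"

definition T3_f :: "(complex \<Rightarrow> complex) \<Rightarrow> complex \<Rightarrow> complex" where
  "T3_f F = (\<lambda>t. - (1/2) * deriv (deriv F) t)"

definition T3_h :: "(complex \<Rightarrow> complex) \<Rightarrow> complex \<Rightarrow> complex" where
  "T3_h F = (\<lambda>t. 1/2 * t * deriv F t + 1/4 * F t)"

text \<open>The linear extension of $e$, $f$, $h$ acting by the operators above; for the coordinates
  of a trace-zero matrix see \<open>sl2_coordinates\<close>.\<close>

definition T3_act :: "complex^2^2 \<Rightarrow> (complex \<Rightarrow> complex) \<Rightarrow> complex \<Rightarrow> complex" where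
  "T3_act A F = fun_scale (A $ 1 $ 2) (T3_e F) + fun_scale (A $ 2 $ 1) (T3_f F)
     + fun_scale (2 * A $ 1 $ 1) (T3_h F)"

lemma T3_act_basis: "T3_act sl2_e = T3_e" "T3_act sl2_f = T3_f" "T3_act sl2_h = T3_h"
  by (simp_all add: T3_act_def fun_scale_def sl2_basis_defs fun_eq_iff)

definition even_polys :: "complex poly set" where
  "even_polys = module.span smult (range (\<lambda>k. monom 1 (2 * k)))"

definition odd_polys :: "complex poly set" where
  "odd_polys = module.span smult (range (\<lambda>k. monom 1 (2 * k + 1)))"

definition T3 :: "complex poly \<Rightarrow> (complex \<Rightarrow> complex) set" where
  "T3 g = range (poly_exp g)"

definition T3_ev :: "complex poly \<Rightarrow> (complex \<Rightarrow> complex) set" where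
  "T3_ev g = poly_exp g ` even_polys"

definition T3_odd :: "complex poly \<Rightarrow> (complex \<Rightarrow> complex) set" where
  "T3_odd g = poly_exp g ` odd_polys"

lemma lie_module_T3: "lie_module sl2_scale sl2 sl2_bracket fun_scale (T3 g) T3_act"
proof -
  interpret lie_algebra sl2_scale sl2 sl2_bracket
    by (rule lie_algebra_sl2)
  interpret F: vector_space fun_scale
    by unfold_locales (simp_all add: fun_scale_def fun_eq_iff algebra_simps)
  have add: "poly_exp g p + poly_exp g q = poly_exp g (p + q)" for p q
    by (simp add: poly_exp_def fun_eq_iff algebra_simps)
  have diff: "poly_exp g p - poly_exp g q = poly_exp g (p - q)" for p q
    by (simp add: poly_exp_def fun_eq_iff algebra_simps)
  have scale: "fun_scale c (poly_exp g p) = poly_exp g (smult c p)" for c p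
    by (simp add: poly_exp_def fun_scale_def fun_eq_iff)
  have zero: "0 = poly_exp g 0"
    by (simp add: poly_exp_def fun_eq_iff)
  define d where "d p = pderiv p + p * pderiv g" for p
  have e: "T3_e (poly_exp g p) = poly_exp g (smult (1/2) (pCons 0 (pCons 0 p)))" for p
    by (simp add: T3_e_def poly_exp_def fun_eq_iff power2_eq_square)
  have f: "T3_f (poly_exp g p) = poly_exp g (smult (-1/2) (d (d p)))" for p
    by (simp add: T3_f_def deriv_poly_exp d_def) (simp add: poly_exp_def)
  have h: "T3_h (poly_exp g p) = poly_exp g (smult (1/2) (pCons 0 (d p)) + smult (1/4) p)" for p
    by (simp add: T3_h_def deriv_poly_exp d_def) (simp add: poly_exp_def fun_eq_iff algebra_simps)
  have d_add: "d (p + q) = d p + d q" for p q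
    by (simp add: d_def pderiv_add algebra_simps)
  have d_diff: "d (p - q) = d p - d q" for p q
    by (simp add: d_def pderiv_diff algebra_simps)
  have d_two: "d (p * 2) = d p * 2" for p
    using d_add[of p p] by (simp add: mult_2_right)
  have d_smult: "d (smult c p) = smult c (d p)" for c p
    by (simp add: d_def pderiv_smult smult_add_right)
  have d_X: "d (pCons 0 p) = p + pCons 0 (d p)" for p
    by (simp add: d_def pderiv_pCons algebra_simps)
  define r where "r A p = smult (A$1$2 / 2) (pCons 0 (pCons 0 p))
      - smult (A$2$1 / 2) (d (d p)) + smult (A$1$1) (pCons 0 (d p)) + smult (A$1$1 / 2) p"
    for A :: "complex^2^2" and p
  have act: "T3_act A (poly_exp g p) = poly_exp g (r A p)" for A p
    unfolding T3_act_def e f h scale add r_def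
    by (rule arg_cong[where f = "poly_exp g"]) (simp add: smult_add_right)
  have r_linear: "r (A + B) p = r A p + r B p" "r A (p + q) = r A p + r A q"
    "r (sl2_scale c A) p = smult c (r A p)" "r A (smult c p) = smult c (r A p)" for A B c p q
    unfolding poly_eq_poly_eq_iff[symmetric] r_def sl2_scale_def
    by (simp_all add: fun_eq_iff d_add d_smult field_simps)
  have r_bracket: "r (sl2_bracket A B) p = r A (r B p) - r B (r A p)"
    if "A \<in> sl2" "B \<in> sl2" for A B p
  proof -
    have tr: "A $ 2 $ 2 = - A $ 1 $ 1" "B $ 2 $ 2 = - B $ 1 $ 1"
      using that by (simp_all add: sl2_def trace_def sum_2 add_eq_0_iff)
    have c: "sl2_bracket A B $ 1 $ 1 = A$1$2 * B$2$1 - B$1$2 * A$2$1"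
      "sl2_bracket A B $ 1 $ 2 = 2 * (A$1$1 * B$1$2 - B$1$1 * A$1$2)"
      "sl2_bracket A B $ 2 $ 1 = 2 * (A$2$1 * B$1$1 - B$2$1 * A$1$1)"
      by (simp_all add: sl2_bracket_def matrix_matrix_mult_def sum_2 tr algebra_simps)
    show ?thesis
      unfolding r_def c poly_eq_poly_eq_iff[symmetric]
      by (simp add: fun_eq_iff d_add d_diff d_two d_smult d_X smult_add_right field_simps)
  qed
  show ?thesis
  proof unfold_locales
    show "F.subspace (T3 g)"
      unfolding F.subspace_def T3_def by (auto simp: zero add scale)
  qed (auto simp: T3_def act add diff scale r_bracket r_linear)
qed

end

theory Submission
  imports Defs
begin

text \<open>Pull a nonzero submodule of $T_3(g)^{\mathrm{ev}}$ or $T_3(g)^{\mathrm{odd}}$ back along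
  $p \mapsto pe^g$ to a space $Q$ of polynomials, on which $\partial$ acts as
  $D = d/dt + g'$. Closure under $t^2$ makes $Q$ closed under multiplication by all even
  polynomials. Since $g$ is even, $tg'$, $g''$, $g'^2$ and $g'/t$ are even, so closure under $tD$
  and $D^2$ amounts to closure under $t\,d/dt$ and $d^2/dt^2$: the polynomial $g$ has disappeared.
  A nonzero element of $Q$ of least degree is then killed by $d^2/dt^2$, hence is a multiple
  of $1$ or of $t$, and multiplying it by powers of $t^2$ gives everything.\<close>

section \<open>Simple submodules\<close>

context lie_module
begin

lemma submodule_imp_lie_module:
  assumes "submodule W"
  shows "lie_module scaleL L bracket scaleV W act"
proof -
  have W: "W \<subseteq> V" "V.subspace W" "\<And>x w. x \<in> L \<Longrightarrow> w \<in> W \<Longrightarrow> act x w \<in> W"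
    using assms by (auto simp: submodule_def)
  show ?thesis
  proof unfold_locales
    show "V.subspace W" by (rule W)
  qed (use W in \<open>auto simp: act_add_left act_add_right act_scale_left act_scale_right
      act_bracket subset_iff\<close>)
qed

text \<open>Lets simplicity be tested inside the ambient module: \<open>W\<close> inherits the
  module axioms from \<open>V\<close>, and its submodules are exactly the submodules of
  \<open>V\<close> contained in it.\<close>

lemma simple_submoduleI:
  assumes W: "submodule W" "W \<noteq> {0}"
    and minimal: "\<And>U. submodule U \<Longrightarrow> U \<subseteq> W \<Longrightarrow> U \<noteq> {0} \<Longrightarrow> W \<subseteq> U"
  shows "simple_lie_module scaleL L bracket scaleV W act"
proof -
  interpret W: lie_module scaleL L bracket scaleV W act
    by (rule submodule_imp_lie_module) (rule W)
  show ?thesis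
  proof unfold_locales
    fix U assume "W.submodule U"
    then have "submodule U" "U \<subseteq> W"
      using W by (auto simp: submodule_def W.submodule_def)
    then show "U = {0} \<or> U = W"
      using minimal by blast
  qed (rule W)
qed

end


section \<open>Parity of polynomials\<close>

text \<open>Only \<open>r\<close> modulo 2 matters. Allowing any natural number makes parities add
  under products and grow by one under differentiation and under multiplication by t.\<close>

definition has_parity :: "nat \<Rightarrow> 'a::zero poly \<Rightarrow> bool" where
  "has_parity r p \<longleftrightarrow> (\<forall>n. coeff p n \<noteq> 0 \<longrightarrow> even (n + r))"

lemma has_parity_0 [simp]: "has_parity r 0"
  by (simp add: has_parity_def)

lemma has_parity_add: "has_parity r p \<Longrightarrow> has_parity r q \<Longrightarrow> has_parity r (p + q)"
  for p q :: "'a::comm_monoid_add poly"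
  unfolding has_parity_def coeff_add by (metis add.right_neutral)

lemma has_parity_smult: "has_parity r p \<Longrightarrow> has_parity r (smult c p)"
  unfolding has_parity_def coeff_smult by (metis mult_zero_right)

lemma has_parity_pCons_0: "has_parity (Suc r) (pCons 0 p) \<longleftrightarrow> has_parity r p"
  by (auto simp: has_parity_def coeff_pCons split: nat.splits)

lemma has_parity_Suc_Suc: "has_parity (Suc (Suc r)) p \<longleftrightarrow> has_parity r p"
  by (auto simp: has_parity_def)

lemma has_parity_pderiv:
  "has_parity r p \<Longrightarrow> has_parity (Suc r) (pderiv p)"
  by (auto simp: has_parity_def coeff_pderiv)

lemma has_parity_mult:
  assumes "has_parity r p" "has_parity s q"
  shows "has_parity (r + s) (p * q)"
  unfolding has_parity_def
proof (intro allI impI)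
  fix n assume "coeff (p * q) n \<noteq> 0"
  then obtain i where i: "i \<le> n" "coeff p i * coeff q (n - i) \<noteq> 0"
    unfolding coeff_mult by (meson atMost_iff sum.not_neutral_contains_not_neutral)
  then have "even (i + r)" "even (n - i + s)"
    using assms unfolding has_parity_def by (metis mult_not_zero)+
  then have "even ((i + r) + (n - i + s))" by simp
  then show "even (n + (r + s))" using i(1) by (simp add: algebra_simps)
qed

lemma vector_space_smult: "vector_space (smult :: 'a::field \<Rightarrow> 'a poly \<Rightarrow> 'a poly)"
  by unfold_locales (simp_all add: smult_add_right smult_add_left)

interpretation poly_space: vector_space "smult :: 'a::field \<Rightarrow> 'a poly \<Rightarrow> 'a poly"
  by (rule vector_space_smult)

text \<open>Parity survives linear combinations. Conversely, each nonzero term of a polynomial of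
  parity \<open>r\<close> is a multiple of a generator, since for \<open>r < 2\<close> the exponents
  start at the lowest one of that parity.\<close>

lemma span_monom_parity:
  assumes "r < 2"
  shows "module.span smult (range (\<lambda>k. monom (1::'a::field) (2 * k + r))) = {p. has_parity r p}"
    (is "poly_space.span ?B = _")
proof (intro equalityI subsetI CollectI)
  fix p assume "p \<in> poly_space.span ?B"
  then show "has_parity r p"
  proof (induction rule: poly_space.span_induct_alt)
    case (step c b q)
    moreover from step have "has_parity r b"
      by (auto simp: has_parity_def split: if_splits)
    ultimately show ?case
      by (simp add: has_parity_add has_parity_smult)
  qed simp
next
  fix p :: "'a poly" assume "p \<in> {p. has_parity r p}"
  then have p: "has_parity r p" by simp
  have "monom (coeff p i) i \<in> poly_space.span ?B" for i
  proof (cases "coeff p i = 0")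
    case False
    then have "even (i + r)" using p by (simp add: has_parity_def)
    then have "i = 2 * (i div 2) + r"
      using assms by presburger
    then have "monom 1 i \<in> ?B" by (metis rangeI)
    then have "smult (coeff p i) (monom 1 i) \<in> poly_space.span ?B"
      by (intro poly_space.span_scale poly_space.span_base)
    then show ?thesis by (simp add: smult_monom)
  qed (simp add: poly_space.span_zero)
  then have "(\<Sum>i\<le>degree p. monom (coeff p i) i) \<in> poly_space.span ?B"
    by (intro poly_space.span_sum)
  then show "p \<in> poly_space.span ?B"
    by (simp add: poly_as_sum_of_monoms)
qed

lemma even_polys_eq: "even_polys = {p. has_parity 0 p}"
  unfolding even_polys_def using span_monom_parity[of 0] by simp

lemma odd_polys_eq: "odd_polys = {p. has_parity 1 p}"
  unfolding odd_polys_def using span_monom_parity[of 1] by simp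


section \<open>Spaces of polynomials closed under the action\<close>

text \<open>Multiplying t^r repeatedly by t^2 reaches all generators. This serves twice: for
  \<open>Q\<close> itself at the end, and with r = 0 for a space of multipliers.\<close>

lemma parity_polys_subset:
  fixes Q :: "'a::field poly set"
  assumes "r < 2" and subspace: "poly_space.subspace Q"
    and X2: "\<And>p. p \<in> Q \<Longrightarrow> pCons 0 (pCons 0 p) \<in> Q"
    and base: "monom 1 r \<in> Q"
  shows "{p. has_parity r p} \<subseteq> Q"
proof -
  have "monom 1 (2 * k + r) \<in> Q" for k
    by (induction k) (use base X2 in \<open>auto simp: monom_Suc\<close>)
  then show ?thesis
    unfolding span_monom_parity[OF \<open>r < 2\<close>, symmetric]
    using subspace by (intro poly_space.span_minimal) auto
qed

text \<open>For fixed \<open>p\<close>, the multipliers \<open>a\<close> with \<open>a * p\<close>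
  in \<open>Q\<close> form a subspace that contains 1 and is closed under multiplication by
  t^2.\<close>

lemma even_mult_closed:
  fixes Q :: "'a::field poly set"
  assumes subspace: "poly_space.subspace Q"
    and X2: "\<And>p. p \<in> Q \<Longrightarrow> pCons 0 (pCons 0 p) \<in> Q"
    and "has_parity 0 a" "p \<in> Q"
  shows "a * p \<in> Q"
proof -
  have "{a. has_parity 0 a} \<subseteq> {a. a * p \<in> Q}"
  proof (rule parity_polys_subset)
    show "poly_space.subspace {a. a * p \<in> Q}"
      using subspace unfolding poly_space.subspace_def by (auto simp: distrib_right)
  qed (use assms in \<open>auto simp: monom_0\<close>)
  with assms show ?thesis by auto
qed

text \<open>The closure hypotheses are those for $t^2$, $tD$ and $D^2$, where $D = d/dt + g'$.\<close>

lemma pderiv2_closed: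
  fixes Q :: "'a::field_char_0 poly set"
  assumes subspace: "poly_space.subspace Q"
    and X2: "\<And>p. p \<in> Q \<Longrightarrow> pCons 0 (pCons 0 p) \<in> Q"
    and XD: "\<And>p. p \<in> Q \<Longrightarrow> pCons 0 (pderiv p + p * pderiv g) \<in> Q"
    and D2: "\<And>p. p \<in> Q \<Longrightarrow>
      pderiv (pderiv p + p * pderiv g) + (pderiv p + p * pderiv g) * pderiv g \<in> Q"
    and g: "has_parity 0 g" and p: "p \<in> Q"
  shows "pderiv (pderiv p) \<in> Q"
proof -
  have g1: "has_parity 1 (pderiv g)"
    using has_parity_pderiv[OF g] by simp
  have g2: "has_parity 0 (pderiv (pderiv g))"
    using has_parity_pderiv[OF g1] by (simp add: has_parity_Suc_Suc)
  have gg: "has_parity 0 (pderiv g * pderiv g)"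
    using has_parity_mult[OF g1 g1] has_parity_Suc_Suc[of 0 "pderiv g * pderiv g"]
    by (simp add: numeral_2_eq_2)
  \<comment> \<open>As g' is odd, t divides it; the quotient \<open>a\<close> = g'/t is
    even.\<close>
  have "coeff (pderiv g) 0 = 0"
    using g1 unfolding has_parity_def by (metis add_0 odd_one)
  then obtain a where a: "pderiv g = pCons 0 a"
    by (cases "pderiv g") auto
  then have a0: "has_parity 0 a"
    using g1 by (simp add: has_parity_pCons_0)
  note mult = even_mult_closed[OF subspace X2]
  have tg: "has_parity 0 (pCons 0 (pderiv g))"
    using g1 has_parity_pCons_0[of 1 "pderiv g"] by (simp add: has_parity_Suc_Suc)
  note minus = poly_space.subspace_diff[OF subspace]
  have "pCons 0 (pderiv p + p * pderiv g) - pCons 0 (pderiv g) * p \<in> Q"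
    by (intro minus XD mult tg p)
  then have tp: "pCons 0 (pderiv p) \<in> Q"
    by (simp add: mult.commute)
  \<comment> \<open>Here D^2 p = p'' + 2 g' p' + g'' p + g'^2 p. Only t p', not p', is known to lie
    in \<open>Q\<close>, so g' p' is written as a (t p') and subtracted twice.\<close>
  have "pderiv (pderiv p + p * pderiv g) + (pderiv p + p * pderiv g) * pderiv g
      - a * pCons 0 (pderiv p) - a * pCons 0 (pderiv p)
      - pderiv (pderiv g) * p - pderiv g * pderiv g * p \<in> Q"
    by (intro minus D2 mult a0 g2 gg p tp)
  also have "a * pCons 0 (pderiv p) = pderiv g * pderiv p"
    by (simp add: a)
  finally show ?thesis
    by (simp add: pderiv_add pderiv_mult algebra_simps)
qed

text \<open>A nonzero element of least degree has zero second derivative, so in characteristic 0 it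
  is linear or constant, and parity leaves it a single term.\<close>

lemma monom_mem_of_pderiv2_closed:
  fixes Q :: "'a::field_char_0 poly set"
  assumes "r < 2" and subspace: "poly_space.subspace Q"
    and parity: "\<And>p. p \<in> Q \<Longrightarrow> has_parity r p"
    and deriv2: "\<And>p. p \<in> Q \<Longrightarrow> pderiv (pderiv p) \<in> Q"
    and nonzero: "\<exists>p\<in>Q. p \<noteq> 0"
  shows "monom 1 r \<in> Q"
proof -
  obtain p where p: "p \<in> Q" "p \<noteq> 0"
    and least: "\<And>q. q \<in> Q \<Longrightarrow> q \<noteq> 0 \<Longrightarrow> degree p \<le> degree q"
    using ex_has_least_nat[of "\<lambda>p. p \<in> Q \<and> p \<noteq> 0" _ degree] nonzero by blast
  have dd: "pderiv (pderiv p) = 0"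
  proof (rule ccontr)
    assume nz: "pderiv (pderiv p) \<noteq> 0"
    then have "degree p \<le> degree (pderiv (pderiv p))"
      using least deriv2 p by blast
    \<comment> \<open>The second derivative has degree \<open>degree p - 2\<close> in truncated
      subtraction, so the inequality is possible only in degree 0.\<close>
    then have "degree p = 0"
      by (simp add: degree_pderiv)
    then show False
      using nz by (simp add: pderiv_eq_0_iff[THEN iffD2])
  qed
  \<comment> \<open>In p'' this coefficient carries the factor (n+1)(n+2), nonzero in characteristic
    0.\<close>
  have "coeff p (Suc (Suc n)) = 0" for n
    using arg_cong[OF dd, of "\<lambda>q. coeff q n"]
    by (simp add: coeff_pderiv del: of_nat_Suc)
  then have high: "coeff p n = 0" if "n \<ge> 2" for n
    using that by (metis add_2_eq_Suc le_Suc_ex)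
  have "coeff p n = 0" if "n \<noteq> r" for n
  proof (rule ccontr)
    assume "coeff p n \<noteq> 0"
    then have "even (n + r)" "n < 2"
      using parity[OF p(1)] high[of n] by (auto simp: has_parity_def not_le[symmetric])
    with \<open>r < 2\<close> that show False by presburger
  qed
  then have eq: "p = monom (coeff p r) r"
    by (auto simp: poly_eq_iff)
  then have "coeff p r \<noteq> 0"
    using p by force
  then have "monom 1 r = smult (inverse (coeff p r)) p"
    by (subst (2) eq) (simp add: smult_monom)
  then show ?thesis
    using subspace p by (simp add: poly_space.subspace_scale)
qed


section \<open>The modules\<close>

lemma poly_exp_0: "poly_exp g 0 = 0"
  by (simp add: poly_exp_def fun_eq_iff)

lemma poly_exp_add: "poly_exp g (p + q) = poly_exp g p + poly_exp g q"
  by (simp add: poly_exp_def fun_eq_iff algebra_simps)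

lemma poly_exp_smult: "poly_exp g (smult c p) = fun_scale c (poly_exp g p)"
  by (simp add: poly_exp_def fun_scale_def fun_eq_iff)

lemma T3_e_poly_exp: "T3_e (poly_exp g p) = poly_exp g (smult (1/2) (pCons 0 (pCons 0 p)))"
  by (simp add: T3_e_def poly_exp_def fun_eq_iff power2_eq_square)

lemma T3_f_poly_exp: "T3_f (poly_exp g p) = poly_exp g (smult (-1/2)
    (pderiv (pderiv p + p * pderiv g) + (pderiv p + p * pderiv g) * pderiv g))"
  by (simp add: T3_f_def deriv_poly_exp) (simp add: poly_exp_def)

lemma T3_h_poly_exp: "T3_h (poly_exp g p) =
    poly_exp g (smult (1/2) (pCons 0 (pderiv p + p * pderiv g)) + smult (1/4) p)"
  by (simp add: T3_h_def deriv_poly_exp) (simp add: poly_exp_def fun_eq_iff algebra_simps)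

text \<open>Treats both modules at once: r = 0 is the even one, r = 1 the odd one.\<close>

lemma simple_lie_module_parity:
  assumes g: "has_parity 0 g" and "r < 2"
  shows "simple_lie_module sl2_scale sl2 sl2_bracket fun_scale
    (poly_exp g ` {p. has_parity r p}) T3_act"
proof -
  interpret lie_module sl2_scale sl2 sl2_bracket fun_scale "T3 g" T3_act
    by (rule lie_module_T3)
  let ?W = "poly_exp g ` {p. has_parity r p}"
  define D where "D p = pderiv p + p * pderiv g" for p
  have D: "has_parity (Suc s) (D p)" if "has_parity s p" for s p
    using has_parity_pderiv[OF that] has_parity_mult[OF that has_parity_pderiv[OF g]]
    by (simp add: D_def has_parity_add)
  have subspace_W: "V.subspace ?W"
    unfolding V.subspace_def
    by (auto simp flip: poly_exp_0[of g] poly_exp_add poly_exp_smult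
        simp: has_parity_add has_parity_smult)
  show ?thesis
  proof (rule simple_submoduleI)
    \<comment> \<open>\<open>T3_act\<close> is a linear combination of these three operators, so
      invariance under them suffices.\<close>
    have "T3_e F \<in> ?W \<and> T3_f F \<in> ?W \<and> T3_h F \<in> ?W" if "F \<in> ?W" for F
    proof -
      obtain p where p: "F = poly_exp g p" "has_parity r p"
        using \<open>F \<in> ?W\<close> by auto
      have "has_parity r (pCons 0 (pCons 0 p))" "has_parity r (D (D p))"
        "has_parity r (pCons 0 (D p))"
        using p D has_parity_Suc_Suc has_parity_pCons_0 by blast+
      then show ?thesis
        unfolding p(1) T3_e_poly_exp T3_f_poly_exp T3_h_poly_exp D_def[symmetric]
        using p by (intro conjI imageI CollectI has_parity_add has_parity_smult)
    qed
    then show "submodule ?W"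
      unfolding submodule_def
      using subspace_W
      by (auto simp: T3_act_def T3_def intro!: V.subspace_add V.subspace_scale)
  next
    have "has_parity r (monom 1 r)" "monom 1 r \<noteq> (0 :: complex poly)"
      by (auto simp: has_parity_def)
    then show "?W \<noteq> {0}"
      using inj_poly_exp[of g] unfolding inj_def
      by (metis (mono_tags, lifting) imageI mem_Collect_eq poly_exp_0 singletonD)
  next
    fix U assume U: "submodule U" "U \<subseteq> ?W" "U \<noteq> {0}"
    define Q where "Q = {p. poly_exp g p \<in> U}"
    have subspace_U: "V.subspace U" and act: "\<And>x w. x \<in> sl2 \<Longrightarrow> w \<in> U \<Longrightarrow> T3_act x w \<in> U"
      using U by (auto simp: submodule_def)
    have efh: "T3_e F \<in> U" "T3_f F \<in> U" "T3_h F \<in> U" if "F \<in> U" for F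
      using act[OF sl2_basis_mem(1) that] act[OF sl2_basis_mem(2) that]
        act[OF sl2_basis_mem(3) that] by (simp_all add: T3_act_basis)
    have subspace_Q: "poly_space.subspace Q"
      using subspace_U unfolding poly_space.subspace_def V.subspace_def Q_def
      by (auto simp: poly_exp_0 poly_exp_add poly_exp_smult)
    \<comment> \<open>Removes the factors 1/2 and -1/2 in the actions of e, f and h.\<close>
    have unscale: "p \<in> Q" if "smult c p \<in> Q" "c \<noteq> 0" for c p
      using poly_space.subspace_scale[OF subspace_Q that(1), of "inverse c"] that(2) by simp
    have X2: "pCons 0 (pCons 0 p) \<in> Q" if "p \<in> Q" for p
      by (rule unscale[of "1/2"]) (use efh(1)[of "poly_exp g p"] that in \<open>simp_all add: Q_def T3_e_poly_exp\<close>)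
    have D2: "D (D p) \<in> Q" if "p \<in> Q" for p
      by (rule unscale[of "-1/2"])
        (use efh(2)[of "poly_exp g p"] that in \<open>simp_all add: Q_def D_def T3_f_poly_exp\<close>)
    \<comment> \<open>On polynomials h acts as (1/2) t D + 1/4; the second summand keeps
      \<open>p\<close> in \<open>Q\<close> and is subtracted first.\<close>
    have XD: "pCons 0 (D p) \<in> Q" if "p \<in> Q" for p
    proof (rule unscale[of "1/2"])
      have "smult (1/2) (pCons 0 (D p)) + smult (1/4) p \<in> Q"
        using efh(3)[of "poly_exp g p"] that unfolding Q_def D_def T3_h_poly_exp by blast
      from poly_space.subspace_diff[OF subspace_Q this
          poly_space.subspace_scale[OF subspace_Q that, of "1/4"]]
      show "smult (1/2) (pCons 0 (D p)) \<in> Q" by (simp add: algebra_simps)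
    qed simp
    \<comment> \<open>Elements of \<open>U\<close> come from polynomials of parity \<open>r\<close>;
      by injectivity of \<open>poly_exp g\<close>, that polynomial is \<open>p\<close>.\<close>
    have "has_parity r p" if "p \<in> Q" for p
      using that U(2) inj_poly_exp[of g] by (auto simp: Q_def inj_def)
    moreover have "pderiv (pderiv p) \<in> Q" if "p \<in> Q" for p
      using pderiv2_closed[OF subspace_Q X2 XD[unfolded D_def] D2[unfolded D_def] g that] .
    moreover have "\<exists>p\<in>Q. p \<noteq> 0"
    proof -
      obtain F where "F \<in> U" "F \<noteq> 0"
        using U(3) V.subspace_0[OF subspace_U] by blast
      then show ?thesis
        using U(2) by (force simp: Q_def poly_exp_0)
    qed
    ultimately have "monom 1 r \<in> Q"
      using monom_mem_of_pderiv2_closed[OF \<open>r < 2\<close> subspace_Q] by blast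
    then show "?W \<subseteq> U"
      using parity_polys_subset[OF \<open>r < 2\<close> subspace_Q X2] by (auto simp: Q_def)
  qed
qed

theorem proposition6p20:
  fixes g :: "complex poly"
  assumes nonconstant: "degree g > 0"
    and even_g: "\<forall>n. odd n \<longrightarrow> coeff g n = 0"
  shows "simple_lie_module sl2_scale sl2 sl2_bracket fun_scale (T3_ev g) T3_act
    \<and> simple_lie_module sl2_scale sl2 sl2_bracket fun_scale (T3_odd g) T3_act"
proof -
  have "has_parity 0 g"
    using even_g by (auto simp: has_parity_def)
  then show ?thesis
    unfolding T3_ev_def T3_odd_def even_polys_eq odd_polys_eq
    by (intro conjI simple_lie_module_parity) simp_all
qed

end
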